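(* Let $u,v\in\mathbb{N}$, let $A$ be a $u\times v$ matrix with rational entries, and let $B$ be a $CR$-set in $(\mathbb{Z},+)$. Assume that for each $a\in\mathbb{Z}$ there exists $\vec{x}\in\mathbb{Z}^{v}$ such that $A\vec{x}=\overline{a}$, where $\overline{a}\in\mathbb{Z}^{u}$ is the vector all of whose entries equal $a$. Then $$\left\{\vec{y}\in\mathbb{Z}^{v}: A\vec{y}\in B^{u}\right\}$$ is a $CR$-set in $(\mathbb{Z}^{v},+)$.
   Context: $\mathbb{N}=\{1,2,3,\ldots\}$. For a set $X$, $\mathcal{P}_f(X)$ denotes the set of nonempty finite subsets of $X$, and ${}^{\mathbb{N}}S$ denotes the set of all functions (sequences) from $\mathbb{N}$ to $S$. Vectors are regarded as column vectors. Let $(S,+)$ be a commutative semigroup, $E\subseteq S$ and $k\in\mathbb{N}$. $E$ is a $k$-$CR$-set in $S$ if and only if there exists $r\in\mathbb{N}$ such that whenever $F\in\mathcal{P}_f({}^{\mathbb{N}}S)$ with $|F|\le k$, there exist $a\in S$ and $H\in\mathcal{P}_f(\{1,2,\ldots,r\})$ such that for all $f\in F$, $a+\sum_{t\in H}f(t)\in E$. $E$ is a $CR$-set (combinatorially rich set) in $S$ if and only if it is a $k$-$CR$-set for every $k\in\mathbb{N}$. (Equivalently: for each $k\in\mathbb{N}$ there exists $r\in\mathbb{N}$ such that for every $r\times k$ matrix $M=(m_{i,j})$ with entries from $S$ there exist $a\in S$ and a nonempty $H\subseteq\{1,\ldots,r\}$ such that $a+\sum_{t\in H}m_{t,j}\in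 E$ for each $j\in\{1,\ldots,k\}$.) *)

theory Defs
  imports "HOL-Analysis.Finite_Cartesian_Product" "HOL-Library.FuncSet"
begin

text \<open>
  The element \<open>a + (\<Sum>t\<in>H. f t)\<close> for a finite set \<open>H\<close>. A commutative semigroup need not
  have a zero, so \<^const>\<open>sum\<close> is not available; folding from the start value \<open>a\<close> avoids it.
\<close>
definition add_sum :: "'a::ab_semigroup_add \<Rightarrow> ('b \<Rightarrow> 'a) \<Rightarrow> 'b set \<Rightarrow> 'a" where
  "add_sum a f H = Finite_Set.fold (\<lambda>t s. f t + s) a H"

lemma add_sum_empty: "add_sum a f {} = a"
  by (simp add: add_sum_def)

lemma add_sum_insert:
  assumes "finite H" "t \<notin> H"
  shows "add_sum a f (insert t H) = f t + add_sum a f H"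
proof -
  interpret comp_fun_commute "\<lambda>t s. f t + s"
    by unfold_locales (auto simp: fun_eq_iff ac_simps)
  show ?thesis
    using assms by (simp add: add_sum_def)
qed

lemma add_sum_eq_sum:
  fixes a :: "'a::comm_monoid_add"
  assumes "finite H"
  shows "add_sum a f H = a + (\<Sum>t\<in>H. f t)"
  using assms by induction (simp_all add: add_sum_empty add_sum_insert ac_simps)

text \<open>
  Sequences are indexed by the positive integers: they are the extensional functions on
  \<open>{1..}\<close>, so that the value at \<open>0\<close> does not influence \<open>card F\<close>.
\<close>
definition k_CR_set :: "nat \<Rightarrow> 'a::ab_semigroup_add set \<Rightarrow> bool" where
  "k_CR_set k E \<longleftrightarrow>
     (\<exists>r::nat. r \<ge> 1 \<and>
       (\<forall>F. F \<subseteq> ({1::nat..} \<rightarrow>\<^sub>E (UNIV :: 'a set)) \<and> finite F \<and> F \<noteq> {} \<and> card F \<le> k \<longrightarrow>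
         (\<exists>a H. H \<subseteq> {1..r} \<and> H \<noteq> {} \<and> (\<forall>f\<in>F. add_sum a f H \<in> E))))"

definition CR_set :: "'a::ab_semigroup_add set \<Rightarrow> bool" where
  "CR_set E \<longleftrightarrow> (\<forall>k\<ge>1. k_CR_set k E)"

definition rat_vec :: "int ^ 'n \<Rightarrow> rat ^ 'n" where
  "rat_vec x = (\<chi> i. of_int (x $ i))"

end

theory Submission imports Defs begin

text \<open>
  If \<open>A\<close> has integer entries, apply richness of \<open>B\<close> to the sequences of entries of \<open>A f(t)\<close> and
  lift the resulting shift \<open>b\<close> to \<open>x\<close> with \<open>A x = b\<close>. In general let \<open>d\<close> be a common
  denominator of \<open>A\<close>. Each block of \<open>d^(k v)\<close> consecutive indices contains a nonempty set over
  which all the given sequences have sum divisible by \<open>d\<close>; summing over these sets first makes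
  the entries integers, and the block length does not depend on the sequences.
\<close>

lemma rat_vec_add: "rat_vec (x + y) = rat_vec x + rat_vec y"
  by (simp add: rat_vec_def vec_eq_iff)

lemma rat_vec_sum: "rat_vec (sum f H) = (\<Sum>t\<in>H. rat_vec (f t))"
  by (induction H rule: infinite_finite_induct)
    (simp_all add: rat_vec_add, simp_all add: rat_vec_def vec_eq_iff)

lemma matrix_vector_mult_sum:
  fixes A :: "'a::semiring_1 ^ 'v ^ 'u"
  shows "A *v sum f H = (\<Sum>t\<in>H. A *v f t)"
  by (induction H rule: infinite_finite_induct) (simp_all add: matrix_vector_right_distrib)

lemma common_denominator:
  fixes q :: "'i \<Rightarrow> rat"
  assumes "finite I"
  shows "\<exists>d::int. d > 0 \<and> (\<forall>i\<in>I. of_int d * q i \<in> \<int>)"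
  using assms
proof induction
  case empty
  show ?case by (rule exI[of _ 1]) simp
next
  case (insert j I)
  then obtain d where d: "d > 0" "\<forall>i\<in>I. of_int d * q i \<in> \<int>"
    by blast
  obtain m n where mn: "quotient_of (q j) = (m, n)"
    by force
  then have n: "n > 0" "q j = of_int m / of_int n"
    by (auto simp: quotient_of_denom_pos quotient_of_div)
  have "of_int (d * n) * q i \<in> \<int>" if "i \<in> insert j I" for i
  proof (cases "i = j")
    case True
    then have "of_int (d * n) * q i = of_int (d * m)"
      using n by simp
    then show ?thesis by (metis Ints_of_int)
  next
    case False
    then have "of_int n * (of_int d * q i) \<in> \<int>"
      using Ints_mult[OF Ints_of_int[of n]] d that False by blast
    then show ?thesis by (simp add: mult_ac)
  qed
  then show ?case
    using d n by (intro exI[of _ "d * n"]) auto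
qed

text \<open>Pigeonhole on prefix sums: reduced modulo \<open>d\<close>, the vectors of prefix sums
  indexed by \<open>J\<close> take at most \<open>d^|J|\<close> values. Two prefixes with the same
  residues differ by an interval, whose sum is divisible by \<open>d\<close> for all
  \<open>j\<close> at once.\<close>

lemma exists_sum_dvd:
  fixes f :: "'j \<Rightarrow> nat \<Rightarrow> int" and d :: int
  assumes "finite J" "d > 0" "nat d ^ card J \<le> N"
  shows "\<exists>K. K \<subseteq> {m<..m + N} \<and> K \<noteq> {} \<and> (\<forall>j\<in>J. d dvd (\<Sum>t\<in>K. f j t))"
proof -
  define p where "p n = (\<lambda>j\<in>J. (\<Sum>t\<in>{m<..m + n}. f j t) mod d)" for n
  have "p ` {..N} \<subseteq> J \<rightarrow>\<^sub>E {0..<d}"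
    using assms(2) by (auto simp: p_def)
  then have "card (p ` {..N}) \<le> card (J \<rightarrow>\<^sub>E {0..<d})"
    using assms(1) by (intro card_mono finite_PiE) auto
  also have "\<dots> = nat d ^ card J"
    using assms(1) by (simp add: card_PiE)
  \<comment> \<open>The inequality is strict because the empty prefix counts too: there are
    \<open>N + 1\<close> prefixes.\<close>
  also have "\<dots> < card {..N}"
    using assms(3) by simp
  finally have "\<not> inj_on p {..N}"
    by (rule pigeonhole)
  then obtain a b where ab: "a < b" "b \<le> N" "p a = p b"
    unfolding inj_on_def by (metis atMost_iff linorder_neqE_nat)
  have "d dvd (\<Sum>t\<in>{m + a<..m + b}. f j t)" if "j \<in> J" for j
  proof -
    have "{m<..m + b} = {m<..m + a} \<union> {m + a<..m + b}"
      using ab by auto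
    moreover have "{m<..m + a} \<inter> {m + a<..m + b} = {}"
      by auto
    ultimately have "(\<Sum>t\<in>{m<..m + b}. f j t)
        = (\<Sum>t\<in>{m<..m + a}. f j t) + (\<Sum>t\<in>{m + a<..m + b}. f j t)"
      by (simp add: sum.union_disjoint)
    moreover have "(\<Sum>t\<in>{m<..m + a}. f j t) mod d = (\<Sum>t\<in>{m<..m + b}. f j t) mod d"
      using fun_cong[OF ab(3), of j] that by (simp add: p_def)
    ultimately show ?thesis
      by (metis add_diff_cancel_left' mod_eq_dvd_iff)
  qed
  moreover have "{m + a<..m + b} \<subseteq> {m<..m + N}" "{m + a<..m + b} \<noteq> {}"
    using ab by auto
  ultimately show ?thesis
    by blast
qed

text \<open>Blocks are numbered from 1. With truncated subtraction the indices 0 and 1 would give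
  the same block, hence the lower bounds on \<open>i\<close> and \<open>j\<close>.\<close>

lemma block_disjoint:
  fixes N :: nat
  assumes "i \<noteq> j" "i \<ge> 1" "j \<ge> 1"
  shows "{(i - 1) * N<..(i - 1) * N + N} \<inter> {(j - 1) * N<..(j - 1) * N + N} = {}"
proof -
  have "(i - 1) * N + N \<le> (j - 1) * N" if "i < j" "i \<ge> 1" for i j
  proof -
    have "(i - 1 + 1) * N \<le> (j - 1) * N"
      using that by (intro mult_le_mono1) linarith
    then show ?thesis by simp
  qed
  then have "(i - 1) * N + N \<le> (j - 1) * N \<or> (j - 1) * N + N \<le> (i - 1) * N"
    using assms by (metis linorder_neqE_nat)
  then show ?thesis by auto
qed

text \<open>The factor \<open>d\<close> in each coordinate of \<open>z\<close> clears the
  denominators of \<open>A\<close>: a summand \<open>A $ i $ j * (d * c)\<close> regroups as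
  \<open>(d * A $ i $ j) * c\<close>.\<close>

lemma mult_vec_Ints:
  fixes A :: "rat ^ 'v ^ 'u" and z :: "int ^ 'v"
  assumes "\<And>i j. of_int d * A $ i $ j \<in> \<int>" "\<And>j. d dvd z $ j"
  shows "(A *v rat_vec z) $ i \<in> \<int>"
proof -
  have "A $ i $ j * of_int (z $ j) \<in> \<int>" for j
  proof -
    obtain c where "z $ j = d * c"
      using assms(2)[of j] by (auto elim: dvdE)
    then have "A $ i $ j * of_int (z $ j) = (of_int d * A $ i $ j) * of_int c"
      by simp
    then show ?thesis
      using assms(1) by (metis Ints_mult Ints_of_int)
  qed
  then show ?thesis
    by (auto simp: matrix_vector_mult_def rat_vec_def intro: Ints_sum)
qed

theorem corollary2p5:
  fixes A :: "rat ^ 'v ^ 'u" and B :: "int set"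
  assumes "CR_set B"
    and "\<forall>a::int. \<exists>x :: int ^ 'v. A *v rat_vec x = vec (of_int a)"
  shows "CR_set {y :: int ^ 'v. \<forall>i. (A *v rat_vec y) $ i \<in> of_int ` B}"
  unfolding CR_set_def
proof (intro allI impI)
  fix k :: nat
  assume k: "k \<ge> 1"
  obtain d :: int where d: "d > 0" "\<And>i j. of_int d * A $ i $ j \<in> \<int>"
    using common_denominator[of "UNIV :: ('u \<times> 'v) set" "\<lambda>(i, j). A $ i $ j"] by auto
  \<comment> \<open>The exponent bounds the number of pairs of a sequence in \<open>F\<close> and a
    coordinate. It uses \<open>k\<close> instead of \<open>card F\<close>, since the bound
    \<open>r * N\<close> must be fixed before \<open>F\<close> is given.\<close>
  define N where "N = nat d ^ (k * CARD('v))"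
  have N: "N \<ge> 1"
    using d by (simp add: N_def)
  \<comment> \<open>Each vector sequence produces one integer sequence per row of
    \<open>A\<close>.\<close>
  have "k_CR_set (k * CARD('u)) B"
    using assms(1) k by (simp add: CR_set_def Suc_le_eq)
  then obtain r where r: "r \<ge> 1"
    "\<forall>G. G \<subseteq> ({1::nat..} \<rightarrow>\<^sub>E (UNIV :: int set)) \<and> finite G \<and> G \<noteq> {} \<and> card G \<le> k * CARD('u) \<longrightarrow>
      (\<exists>a H. H \<subseteq> {1..r} \<and> H \<noteq> {} \<and> (\<forall>g\<in>G. add_sum a g H \<in> B))"
    unfolding k_CR_set_def by (elim exE conjE) (rule that)
  show "k_CR_set k {y :: int ^ 'v. \<forall>i. (A *v rat_vec y) $ i \<in> of_int ` B}"
    unfolding k_CR_set_def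
  proof (intro exI[of _ "r * N"] conjI allI impI, goal_cases)
    case 1
    show ?case using r(1) N by (simp add: Suc_le_eq)
  next
    case (2 F)
    then have F: "finite F" "F \<noteq> {}" "card F \<le> k" by auto
    let ?P = "\<lambda>n K. K \<subseteq> {(n - 1) * N<..(n - 1) * N + N} \<and> K \<noteq> {} \<and>
        (\<forall>f\<in>F. \<forall>j. d dvd (\<Sum>t\<in>K. f t $ j))"
    have "\<exists>K. ?P n K" for n
    proof -
      have "nat d ^ card (F \<times> (UNIV :: 'v set)) \<le> N"
        unfolding N_def using d F by (intro power_increasing) (auto simp: card_cartesian_product)
      then obtain K where "K \<subseteq> {(n - 1) * N<..(n - 1) * N + N}" "K \<noteq> {}"
        "\<forall>(f, j)\<in>F \<times> (UNIV :: 'v set). d dvd (\<Sum>t\<in>K. f t $ j)"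
        using exists_sum_dvd[of "F \<times> (UNIV :: 'v set)" d N "(n - 1) * N" "\<lambda>(f, j) t. f t $ j"] d F
        by (auto simp: case_prod_unfold)
      then show ?thesis
        by (intro exI[of _ K]) simp
    qed
    then have "\<exists>K. \<forall>n. ?P n (K n)"
      by (intro choice allI)
    then obtain K where "\<forall>n. ?P n (K n)" ..
    then have K: "\<And>n. K n \<subseteq> {(n - 1) * N<..(n - 1) * N + N}" "\<And>n. K n \<noteq> {}"
      "\<And>n f j. f \<in> F \<Longrightarrow> d dvd (\<Sum>t\<in>K n. f t $ j)"
      by blast+
    have finK: "finite (K n)" for n
      using K(1) finite_subset by blast
    \<comment> \<open>The floor only converts to \<open>int\<close>: for \<open>f\<close> in
      \<open>F\<close> and positive \<open>n\<close> the entry is already an integer. Restricting to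
      \<open>{1..}\<close> makes \<open>g f i\<close> extensional, as the definition of richness
      demands.\<close>
    define g where "g f i = (\<lambda>n\<in>{1..}. \<lfloor>(A *v rat_vec (\<Sum>t\<in>K n. f t)) $ i\<rfloor>)" for f i
    have g: "of_int (g f i n) = (A *v rat_vec (\<Sum>t\<in>K n. f t)) $ i" if "f \<in> F" "n \<ge> 1" for f i n
    proof -
      have "(A *v rat_vec (\<Sum>t\<in>K n. f t)) $ i \<in> \<int>"
        using d(2) K(3)[OF that(1)] by (intro mult_vec_Ints[where d = d]) auto
      then show ?thesis
        using that by (simp add: g_def)
    qed
    define G where "G = (\<lambda>(f, i). g f i) ` (F \<times> UNIV)"
    have "card G \<le> card (F \<times> (UNIV :: 'u set))"
      unfolding G_def using F by (intro card_image_le) simp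
    also have "\<dots> \<le> k * CARD('u)"
      using F by (simp add: card_cartesian_product)
    finally have "card G \<le> k * CARD('u)" .
    moreover have "G \<subseteq> {1..} \<rightarrow>\<^sub>E UNIV" "finite G" "G \<noteq> {}"
      using F by (auto simp: G_def g_def)
    ultimately obtain b H where H: "H \<subseteq> {1..r}" "H \<noteq> {}" "\<And>h. h \<in> G \<Longrightarrow> add_sum b h H \<in> B"
      using r(2)[rule_format, of G] by blast
    have finH: "finite H"
      using H(1) finite_subset by blast
    \<comment> \<open>Richness gives one shift \<open>b\<close> for all rows, so the vector to be
      lifted is constant, which is the case that the hypothesis on \<open>A\<close> covers.\<close>
    obtain x where x: "A *v rat_vec x = vec (of_int b)"
      using assms(2) by blast
    \<comment> \<open>The witnesses are \<open>x\<close> and \<open>?L\<close>, the union of the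
      chosen subsets of the blocks numbered by \<open>H\<close>; the first \<open>r\<close> blocks
      fill \<open>{1..r * N}\<close>.\<close>
    let ?L = "\<Union>n\<in>H. K n"
    have "K n \<subseteq> {1..r * N}" if "n \<in> H" for n
    proof -
      have n: "1 \<le> n" "n \<le> r"
        using that H(1) by auto
      then have "(n - 1) * N + N = n * N"
        by (cases n) auto
      also have "\<dots> \<le> r * N"
        using n by simp
      finally show ?thesis
        using K(1)[of n] by fastforce
    qed
    then have L: "?L \<subseteq> {1..r * N}" "?L \<noteq> {}" "finite ?L"
      using K(2) H(2) finH finK by auto
    have disj: "K m \<inter> K n = {}" if "m \<in> H" "n \<in> H" "m \<noteq> n" for m n
    proof -
      have "m \<ge> 1" "n \<ge> 1"
        using that H(1) by auto
      then show ?thesis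
        using block_disjoint[OF that(3), of N] K(1)[of m] K(1)[of n] by blast
    qed
    have "(A *v rat_vec (add_sum x f ?L)) $ i \<in> of_int ` B" if f: "f \<in> F" for f i
    proof -
      \<comment> \<open>As the blocks are disjoint, summing \<open>f\<close> over \<open>?L\<close>
        amounts to summing the block sums over \<open>H\<close>, and row \<open>i\<close> of
        \<open>A\<close> turns these into the values of \<open>g f i\<close>.\<close>
      have "(\<Sum>t\<in>?L. f t) = (\<Sum>n\<in>H. \<Sum>t\<in>K n. f t)"
        using disj finH finK by (intro sum.UNION_disjoint) auto
      then have "A *v rat_vec (add_sum x f ?L)
          = vec (of_int b) + (\<Sum>n\<in>H. A *v rat_vec (\<Sum>t\<in>K n. f t))"
        using x by (simp add: add_sum_eq_sum[OF L(3)] rat_vec_add rat_vec_sum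
            matrix_vector_right_distrib matrix_vector_mult_sum)
      then have "(A *v rat_vec (add_sum x f ?L)) $ i
          = of_int b + (\<Sum>n\<in>H. (A *v rat_vec (\<Sum>t\<in>K n. f t)) $ i)"
        by simp
      also have "(\<Sum>n\<in>H. (A *v rat_vec (\<Sum>t\<in>K n. f t)) $ i) = (\<Sum>n\<in>H. of_int (g f i n))"
        using H(1) by (intro sum.cong) (auto simp: g[OF f])
      finally have "(A *v rat_vec (add_sum x f ?L)) $ i = of_int (add_sum b (g f i) H)"
        by (simp add: add_sum_eq_sum[OF finH])
      moreover have "add_sum b (g f i) H \<in> B"
        using f by (intro H(3)) (auto simp: G_def)
      ultimately show ?thesis
        by simp
    qed
    then show ?case
      using L by blast
  qed
qed

end
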